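(* Let $n\ge3$ be an integer and $a\ge1$ a real number. Let $\mathrm{CI}_{a}(n)$ be the supremum of $\epsilon^*(A_b,A_w)$ over all pairwise comparison systems $(A_b,A_w)$ on $n$ criteria with $a_{bw}=a$. Then $$\mathrm{CI}_{a}(n)=\begin{cases}\dfrac{2a+1-\sqrt{8a+1}}{2}&\text{if }n=3,\\[2mm] \max\left\{\dfrac{2a+1-\sqrt{8a+1}}{2},\ \dfrac{a^2-1}{2a+2}\right\}&\text{if }n\ge4.\end{cases}$$
   Context: Let $C=\{1,\dots,n\}$ be the set of criteria, $b\ne w$ in $C$ the best and worst criterion, $D=C\setminus\{b,w\}$. A pairwise comparison system (PCS) is a pair $(A_b,A_w)$ with $A_b=(a_{b1},\dots,a_{bn})$ and $A_w=(a_{1w},\dots,a_{nw})^T$ of real numbers, with $a_{bb}=a_{ww}=1$ and $1\le a_{bi},a_{iw}\le a_{bw}$ for all $i\in D$. $\epsilon^*(A_b,A_w)$ is the optimal objective value of $$\min\ \epsilon\quad\text{s.t.}\quad \left|\frac{w_b}{w_i}-a_{bi}\right|\le\epsilon,\ \left|\frac{w_i}{w_w}-a_{iw}\right|\le\epsilon,\ \left|\frac{w_b}{w_w}-a_{bw}\right|\le\epsilon,\ \sum_{j\in C}w_j=1,\ w_j\ge0\ \text{ for all } i\in D,\ j\in C,$$ where denominators are required to be nonzero. $\mathrm{CI}$ is called the consistency index. *)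

theory Defs
  imports "HOL-Library.Extended_Real"
begin

definition criteria :: "nat \<Rightarrow> nat set" where
  "criteria n = {1..n}"

text \<open>
  The vectors \<open>A\<^sub>b\<close> and \<open>A\<^sub>w\<close> are functions \<open>nat \<Rightarrow> real\<close> of which only the values on
  \<open>criteria n\<close> matter: \<open>Ab i\<close> is \<open>a\<^sub>b\<^sub>i\<close> and \<open>Aw i\<close> is \<open>a\<^sub>i\<^sub>w\<close>.  The number \<open>a\<^sub>b\<^sub>w\<close> is an entry
  of both vectors, hence the condition \<open>Ab w = Aw b\<close>.
\<close>

definition is_pcs :: "nat \<Rightarrow> nat \<Rightarrow> nat \<Rightarrow> (nat \<Rightarrow> real) \<Rightarrow> (nat \<Rightarrow> real) \<Rightarrow> bool" where
  "is_pcs n b w Ab Aw \<longleftrightarrow>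
     Ab b = 1 \<and> Aw w = 1 \<and> Ab w = Aw b \<and>
     (\<forall>i \<in> criteria n - {b, w}. 1 \<le> Ab i \<and> Ab i \<le> Ab w \<and> 1 \<le> Aw i \<and> Aw i \<le> Ab w)"

text \<open>
  Feasibility of the weights \<open>v\<close> with objective value \<open>e\<close>.  Division by zero is total in HOL, so
  the weights occurring as denominators are explicitly required to be nonzero; \<open>v b\<close> is not one
  of them.
\<close>

definition feasible ::
  "nat \<Rightarrow> nat \<Rightarrow> nat \<Rightarrow> (nat \<Rightarrow> real) \<Rightarrow> (nat \<Rightarrow> real) \<Rightarrow> (nat \<Rightarrow> real) \<Rightarrow> real \<Rightarrow> bool" where
  "feasible n b w Ab Aw v e \<longleftrightarrow>
     (\<forall>i \<in> criteria n - {b, w}. v i \<noteq> 0) \<and> v w \<noteq> 0 \<and>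
     (\<forall>i \<in> criteria n - {b, w}. \<bar>v b / v i - Ab i\<bar> \<le> e \<and> \<bar>v i / v w - Aw i\<bar> \<le> e) \<and>
     \<bar>v b / v w - Ab w\<bar> \<le> e \<and>
     (\<Sum>j\<in>criteria n. v j) = 1 \<and> (\<forall>j \<in> criteria n. 0 \<le> v j)"

text \<open>
  The optimal value and the consistency index are taken in the extended reals, where infima and
  suprema carry no default values for empty or unbounded sets.
\<close>

definition eps_star ::
  "nat \<Rightarrow> nat \<Rightarrow> nat \<Rightarrow> (nat \<Rightarrow> real) \<Rightarrow> (nat \<Rightarrow> real) \<Rightarrow> ereal" where
  "eps_star n b w Ab Aw = Inf {ereal e | e. \<exists>v. feasible n b w Ab Aw v e}"

definition CI :: "nat \<Rightarrow> nat \<Rightarrow> real \<Rightarrow> nat \<Rightarrow> ereal" where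
  "CI b w a n = Sup {eps_star n b w Ab Aw | Ab Aw. is_pcs n b w Ab Aw \<and> Ab w = a}"

end

theory Submission
  imports Defs
begin

text \<open>
  After division by \<open>v w\<close> the weights are described by \<open>x = v b / v w\<close> and \<open>y = v i / v w\<close>, and the
  constraints of a criterion \<open>i\<close> with comparisons \<open>p\<close>, \<open>q\<close> read \<open>\<bar>x / y - p\<bar> \<le> e\<close> and \<open>\<bar>y - q\<bar> \<le> e\<close>.
  Since \<open>x\<close> is the product of \<open>x / y\<close> and \<open>y\<close>, for \<open>x > 0\<close> these can be met by some \<open>y > 0\<close>
  exactly when \<open>(p - e) * (q - e) \<le> x \<le> (p + e) * (q + e)\<close>, where the lower bound is void if a factor is not
  positive (\<open>middle_criterion_bounds\<close>, \<open>middle_criterion_exists\<close>).  The criteria interact only through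
  \<open>x\<close>, so \<open>e\<close> is attainable iff the intervals of all criteria and the interval \<open>[a - e, a + e]\<close> have
  a common positive point.

  By Helly's theorem on the line only pairs of intervals matter.  The worst conflict between one
  criterion and \<open>[a - e, a + e]\<close> is \<open>p = q = a\<close>, which forces \<open>(a - e)\<^sup>2 \<le> a + e\<close>; its critical solution
  \<open>e\<close> is \<open>single_bound a\<close>.  The opposite conflict \<open>p = q = 1\<close>, forcing \<open>a - e \<le> (1 + e)\<^sup>2\<close>, is never
  the stronger one (\<open>single_bound_le_square\<close>).  Two criteria conflict most if \<open>p = q = a\<close> for
  one and \<open>p = q = 1\<close> for the other: then \<open>(a - e)\<^sup>2 \<le> (1 + e)\<^sup>2\<close>, that is \<open>e \<ge> (a - 1) / 2\<close>.  This
  second kind of conflict needs two criteria besides \<open>b\<close> and \<open>w\<close>, whence the case distinction;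
  note that \<open>(a\<^sup>2 - 1) / (2 * a + 2) = (a - 1) / 2\<close>.
\<close>

section \<open>One criterion between the best and the worst\<close>

lemma middle_criterion_bounds:
  fixes x y p q e :: real
  assumes "0 \<le> x" "0 < y" "\<bar>x / y - p\<bar> \<le> e" "\<bar>y - q\<bar> \<le> e"
  shows "e \<le> p \<Longrightarrow> e \<le> q \<Longrightarrow> (p - e) * (q - e) \<le> x" and "x \<le> (p + e) * (q + e)"
proof -
  have x: "x = (x / y) * y" and "0 \<le> x / y"
    using assms by auto
  have "(p - e) * (q - e) \<le> (x / y) * y" if "e \<le> p" "e \<le> q"
    using that assms by (intro mult_mono) auto
  then show "(p - e) * (q - e) \<le> x" if "e \<le> p" "e \<le> q"
    using that x by simp
  have "x / y \<le> p + e" "y \<le> q + e"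
    using assms by linarith+
  then have "(x / y) * y \<le> (p + e) * (q + e)"
    using assms \<open>0 \<le> x / y\<close> by (intro mult_mono) linarith+
  then show "x \<le> (p + e) * (q + e)"
    using x by simp
qed

lemma middle_criterion_exists:
  fixes x p q e :: real
  assumes "0 < x" "0 \<le> e" "0 < p"
    and lower: "e < p \<Longrightarrow> e < q \<Longrightarrow> (p - e) * (q - e) \<le> x"
    and upper: "x \<le> (p + e) * (q + e)"
  shows "\<exists>y>0. \<bar>x / y - p\<bar> \<le> e \<and> \<bar>y - q\<bar> \<le> e"
proof -
  \<comment> \<open>The least \<open>y\<close> allowed by \<open>q - e \<le> y\<close> and \<open>x / y \<le> p + e\<close>.\<close>
  define y where "y = max (q - e) (x / (p + e))"
  have pe: "0 < p + e" using assms by simp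
  have y0: "0 < y" using assms pe by (auto simp: y_def less_max_iff_disj)
  have "x / (p + e) \<le> q + e"
    using upper pe by (simp add: divide_le_eq mult.commute)
  then have yq: "\<bar>y - q\<bar> \<le> e"
    using \<open>0 \<le> e\<close> by (auto simp: y_def abs_le_iff max_def)
  have "x / (p + e) \<le> y" by (simp add: y_def)
  then have xy1: "x / y \<le> p + e"
    using pe y0 by (simp add: divide_le_eq mult.commute)
  have "(p - e) * y \<le> x"
  proof (cases "p \<le> e")
    case True
    then show ?thesis using y0 \<open>0 < x\<close> mult_nonpos_nonneg[of "p - e" y] by simp
  next
    case False
    show ?thesis
    proof (cases "q - e \<le> x / (p + e)")
      case True
      then have "y = x / (p + e)" by (simp add: y_def)
      moreover have "(p - e) * x \<le> x * (p + e)"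
        using \<open>0 \<le> e\<close> \<open>0 < x\<close> by (simp add: mult.commute mult_left_mono)
      ultimately show ?thesis using pe by (simp add: divide_le_eq)
    next
      case False
      then have "y = q - e" by (simp add: y_def)
      then show ?thesis using lower y0 \<open>\<not> p \<le> e\<close> by simp
    qed
  qed
  then have "p - e \<le> x / y" using y0 by (simp add: le_divide_eq)
  with xy1 yq y0 show ?thesis by (intro exI[of _ y]) auto
qed

section \<open>Feasibility in terms of the ratio of the extreme weights\<close>

lemma feasible_ratio:
  assumes feas: "feasible n b w Ab Aw v e" and "b \<in> criteria n" "w \<in> criteria n"
  obtains x where "\<bar>x - Ab w\<bar> \<le> e"
    and "\<And>i. i \<in> criteria n - {b, w} \<Longrightarrow> e \<le> Ab i \<Longrightarrow> e \<le> Aw i \<Longrightarrow> (Ab i - e) * (Aw i - e) \<le> x"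
    and "\<And>i. i \<in> criteria n - {b, w} \<Longrightarrow> x \<le> (Ab i + e) * (Aw i + e)"
proof -
  define x where "x = v b / v w"
  have vw: "0 < v w" and vb: "0 \<le> v b"
    using assms by (force simp: feasible_def)+
  have x0: "0 \<le> x" using vw vb by (simp add: x_def)
  have i: "0 < v i / v w \<and> \<bar>x / (v i / v w) - Ab i\<bar> \<le> e \<and> \<bar>v i / v w - Aw i\<bar> \<le> e"
    if "i \<in> criteria n - {b, w}" for i
  proof -
    have "0 < v i" using feas that by (force simp: feasible_def)
    then show ?thesis using feas that vw by (simp add: feasible_def x_def)
  qed
  show thesis
  proof (rule that[of x])
    show "\<bar>x - Ab w\<bar> \<le> e" using feas by (simp add: feasible_def x_def)
  qed (use middle_criterion_bounds[OF x0] i in blast)+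
qed

lemma ratio_feasible:
  assumes pcs: "is_pcs n b w Ab Aw"
    and mem: "b \<in> criteria n" "w \<in> criteria n" "b \<noteq> w"
    and x: "0 < x" "\<bar>x - Ab w\<bar> \<le> e"
    and lower: "\<And>i. i \<in> criteria n - {b, w} \<Longrightarrow> e < Ab i \<Longrightarrow> e < Aw i \<Longrightarrow>
                  (Ab i - e) * (Aw i - e) \<le> x"
    and upper: "\<And>i. i \<in> criteria n - {b, w} \<Longrightarrow> x \<le> (Ab i + e) * (Aw i + e)"
  shows "\<exists>v. feasible n b w Ab Aw v e"
proof -
  have "\<forall>i\<in>criteria n - {b, w}. \<exists>y>0. \<bar>x / y - Ab i\<bar> \<le> e \<and> \<bar>y - Aw i\<bar> \<le> e"
  proof
    fix i assume i: "i \<in> criteria n - {b, w}"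
    then have "1 \<le> Ab i" using pcs by (simp add: is_pcs_def)
    then show "\<exists>y>0. \<bar>x / y - Ab i\<bar> \<le> e \<and> \<bar>y - Aw i\<bar> \<le> e"
      using x i by (intro middle_criterion_exists lower upper) auto
  qed
  then obtain y where y: "\<And>i. i \<in> criteria n - {b, w} \<Longrightarrow>
      0 < y i \<and> \<bar>x / y i - Ab i\<bar> \<le> e \<and> \<bar>y i - Aw i\<bar> \<le> e"
    by metis
  define u where "u = (\<lambda>i. if i = b then x else if i = w then 1 else y i)"
  define s where "s = sum u (criteria n)"
  have u0: "0 < u i" if "i \<in> criteria n" for i
    using that x y by (auto simp: u_def)
  have s0: "0 < s"
    unfolding s_def using u0 mem by (intro sum_pos) (auto simp: criteria_def)
  have "(\<Sum>i\<in>criteria n. u i / s) = 1"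
    using s0 by (simp add: s_def flip: sum_divide_distrib)
  then have "feasible n b w Ab Aw (\<lambda>i. u i / s) e"
    using s0 u0 x y mem by (auto simp: feasible_def u_def less_imp_le less_imp_neq[symmetric])
  then show ?thesis by blast
qed

lemma eps_star_le:
  assumes "\<exists>v. feasible n b w Ab Aw v e"
  shows "eps_star n b w Ab Aw \<le> ereal e"
  unfolding eps_star_def using assms by (intro Inf_lower) auto

lemma le_eps_star:
  assumes "\<And>v e. feasible n b w Ab Aw v e \<Longrightarrow> c \<le> e"
  shows "ereal c \<le> eps_star n b w Ab Aw"
  unfolding eps_star_def using assms by (intro Inf_greatest) auto

section \<open>The error forced by a single criterion\<close>

definition single_bound :: "real \<Rightarrow> real" where
  "single_bound a = (2 * a + 1 - sqrt (8 * a + 1)) / 2"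

lemma single_bound_square:
  assumes "0 \<le> a"
  shows "(a - single_bound a)\<^sup>2 = a + single_bound a"
proof -
  have "(sqrt (8 * a + 1))\<^sup>2 = 8 * a + 1" using assms by simp
  then show ?thesis by (simp add: single_bound_def power2_eq_square field_simps)
qed

lemma single_bound_le:
  assumes "1 \<le> a"
  shows "single_bound a \<le> a - 1"
proof -
  have "3 \<le> sqrt (8 * a + 1)" using assms by (intro real_le_rsqrt) auto
  then show ?thesis by (simp add: single_bound_def)
qed

lemma single_bound_nonneg:
  assumes "1 \<le> a"
  shows "0 \<le> single_bound a"
proof -
  have "8 * a + 1 \<le> (2 * a + 1)\<^sup>2"
    using assms mult_left_mono[of 1 a "4 * a"] by (simp add: power2_eq_square field_simps)
  then have "sqrt (8 * a + 1) \<le> 2 * a + 1" using assms by (intro real_le_lsqrt) auto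
  then show ?thesis by (simp add: single_bound_def)
qed

text \<open>
  On \<open>e \<le> a\<close> the left-hand side decreases and the right-hand side increases in \<open>e\<close>, and
  \<open>single_bound a\<close> is where they meet.
\<close>

lemma square_le_iff_single_bound_le:
  assumes "1 \<le> a" "e \<le> a"
  shows "(a - e)\<^sup>2 \<le> a + e \<longleftrightarrow> single_bound a \<le> e"
proof
  assume "single_bound a \<le> e"
  then have "(a - e)\<^sup>2 \<le> (a - single_bound a)\<^sup>2"
    using assms by (intro power_mono) auto
  then show "(a - e)\<^sup>2 \<le> a + e"
    using single_bound_square[of a] assms \<open>single_bound a \<le> e\<close> by simp
next
  assume le: "(a - e)\<^sup>2 \<le> a + e"
  show "single_bound a \<le> e"
  proof (rule ccontr)
    assume "\<not> single_bound a \<le> e"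
    then have "(a - single_bound a)\<^sup>2 \<le> (a - e)\<^sup>2"
      using single_bound_le[of a] assms by (intro power_mono) auto
    then show False
      using le single_bound_square[of a] assms \<open>\<not> single_bound a \<le> e\<close> by simp
  qed
qed

text \<open>
  With \<open>t = a - e\<close> for \<open>e = single_bound a\<close> one has \<open>t\<^sup>2 = a + e\<close>, so \<open>2 * e = t\<^sup>2 - t\<close>.  Hence
  \<open>(1 + e)\<^sup>2 \<ge> 1 + 2 * e = t + (t - 1)\<^sup>2 \<ge> t\<close>.
\<close>

lemma single_bound_le_square:
  assumes "1 \<le> a"
  shows "a - single_bound a \<le> (1 + single_bound a)\<^sup>2"
proof -
  define e where "e = single_bound a"
  define t where "t = a - e"
  have "2 * e = t\<^sup>2 - t"
    using single_bound_square[of a] assms by (simp add: t_def e_def)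
  moreover have "0 \<le> (t - 1)\<^sup>2" "0 \<le> e\<^sup>2" by simp_all
  ultimately have "t \<le> (1 + e)\<^sup>2" unfolding power2_diff power2_sum by linarith
  then show ?thesis by (simp add: t_def e_def)
qed

section \<open>Upper bounds\<close>

text \<open>
  The largest candidate for \<open>x\<close> is the smaller of the two right ends \<open>a + e\<close> and \<open>(Ab i + e) * (Aw i + e)\<close>:
  it suffices to place each left end below each right end.
\<close>

lemma eps_star_le_single_bound:
  assumes pcs: "is_pcs 3 b w Ab Aw" and a: "Ab w = a" "1 \<le> a"
    and mem: "b \<in> criteria 3" "w \<in> criteria 3" "b \<noteq> w"
  shows "eps_star 3 b w Ab Aw \<le> ereal (single_bound a)"
proof -
  define e where "e = single_bound a"
  have "card (criteria 3 - {b, w}) = 1"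
    using mem by (simp add: card_Diff_subset criteria_def)
  then obtain i where D: "criteria 3 - {b, w} = {i}"
    by (rule card_1_singletonE)
  then have pq: "1 \<le> Ab i" "Ab i \<le> a" "1 \<le> Aw i" "Aw i \<le> a"
    using pcs a by (auto simp: is_pcs_def)
  have e: "0 \<le> e" "e < a" "(a - e)\<^sup>2 \<le> a + e" "a - e \<le> (1 + e)\<^sup>2"
    using single_bound_nonneg[of a] single_bound_le[of a] single_bound_square[of a]
      single_bound_le_square[of a] a by (auto simp: e_def)
  define x where "x = min (a + e) ((Ab i + e) * (Aw i + e))"
  have "(1 + e) * (1 + e) \<le> (Ab i + e) * (Aw i + e)"
    using e pq by (intro mult_mono) auto
  then have x: "a - e \<le> x" using e by (simp add: x_def power2_eq_square)
  have "(Ab i - e) * (Aw i - e) \<le> x" if "e < Ab i" "e < Aw i"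
  proof -
    have "(Ab i - e) * (Aw i - e) \<le> (a - e) * (a - e)"
      using that pq by (intro mult_mono) auto
    moreover have "(Ab i - e) * (Aw i - e) \<le> (Ab i + e) * (Aw i + e)"
      using that e by (intro mult_mono) auto
    ultimately show ?thesis using e by (simp add: x_def power2_eq_square)
  qed
  moreover have "0 < x" "\<bar>x - Ab w\<bar> \<le> e"
    using x e a by (auto simp: x_def)
  ultimately have "\<exists>v. feasible 3 b w Ab Aw v e"
    using pcs mem D by (intro ratio_feasible[where x = x]) (auto simp: x_def)
  then show ?thesis unfolding e_def by (rule eps_star_le)
qed

text \<open>
  Here \<open>x = (1 + e)\<^sup>2\<close> or \<open>x = a + e\<close>, whichever is smaller, serves all criteria simultaneously,
  independently of the comparisons.
\<close>

lemma eps_star_le_max: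
  assumes pcs: "is_pcs n b w Ab Aw" and a: "Ab w = a" "1 \<le> a"
    and mem: "b \<in> criteria n" "w \<in> criteria n" "b \<noteq> w"
  shows "eps_star n b w Ab Aw \<le> ereal (max (single_bound a) ((a - 1) / 2))"
proof -
  define e where "e = max (single_bound a) ((a - 1) / 2)"
  have "single_bound a \<le> e" "(a - 1) / 2 \<le> e" "e \<le> a - 1"
    using single_bound_le[of a] a by (auto simp: e_def)
  then have e: "0 \<le> e" "e < a" "a - e \<le> 1 + e"
    using single_bound_nonneg[of a] a by auto
  have sq: "(a - e)\<^sup>2 \<le> a + e"
    using a e by (subst square_le_iff_single_bound_le) (auto simp: e_def)
  have "1 + e \<le> (1 + e)\<^sup>2" using e by (simp add: power2_eq_square)
  define x where "x = min (a + e) ((1 + e)\<^sup>2)"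
  have "(a - e)\<^sup>2 \<le> (1 + e)\<^sup>2" using e by (intro power_mono) auto
  then have sqx: "(a - e)\<^sup>2 \<le> x" using sq by (simp add: x_def)
  have x: "a - e \<le> x" using e \<open>1 + e \<le> (1 + e)\<^sup>2\<close> by (simp add: x_def)
  have pq: "1 \<le> Ab i \<and> Ab i \<le> a \<and> 1 \<le> Aw i \<and> Aw i \<le> a" if "i \<in> criteria n - {b, w}" for i
    using that pcs a(1) unfolding is_pcs_def by blast
  have "(Ab i - e) * (Aw i - e) \<le> x"
    if "i \<in> criteria n - {b, w}" "e < Ab i" "e < Aw i" for i
  proof -
    have "(Ab i - e) * (Aw i - e) \<le> (a - e) * (a - e)"
      using that pq[OF that(1)] by (intro mult_mono) auto
    then show ?thesis using sqx by (simp add: power2_eq_square)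
  qed
  moreover have "x \<le> (Ab i + e) * (Aw i + e)" if "i \<in> criteria n - {b, w}" for i
  proof -
    have "(1 + e) * (1 + e) \<le> (Ab i + e) * (Aw i + e)"
      using e pq[OF that] by (intro mult_mono) auto
    then show ?thesis by (simp add: x_def power2_eq_square)
  qed
  moreover have "0 < x" "\<bar>x - Ab w\<bar> \<le> e"
    using x e a by (auto simp: x_def)
  ultimately have "\<exists>v. feasible n b w Ab Aw v e"
    using pcs mem by (intro ratio_feasible[where x = x]) auto
  then show ?thesis unfolding e_def by (rule eps_star_le)
qed

section \<open>Extremal systems\<close>

lemma single_bound_le_eps_star:
  assumes "1 \<le> a" "b \<in> criteria n" "w \<in> criteria n"
    and "Ab w = a" and i: "i \<in> criteria n - {b, w}" "Ab i = a" "Aw i = a"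
  shows "ereal (single_bound a) \<le> eps_star n b w Ab Aw"
proof (rule le_eps_star)
  fix v e assume "feasible n b w Ab Aw v e"
  then obtain x where x: "\<bar>x - Ab w\<bar> \<le> e"
    "e \<le> Ab i \<Longrightarrow> e \<le> Aw i \<Longrightarrow> (Ab i - e) * (Aw i - e) \<le> x"
    using feasible_ratio assms by metis
  show "single_bound a \<le> e"
  proof (cases "e \<le> a")
    case True
    then have "(a - e)\<^sup>2 \<le> a + e" using x assms by (simp add: power2_eq_square)
    then show ?thesis using square_le_iff_single_bound_le assms True by blast
  next
    case False
    then show ?thesis using single_bound_le assms by fastforce
  qed
qed

lemma half_le_eps_star:
  assumes "1 \<le> a" "b \<in> criteria n" "w \<in> criteria n"
    and i: "i \<in> criteria n - {b, w}" "Ab i = a" "Aw i = a"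
    and j: "j \<in> criteria n - {b, w}" "Ab j = 1" "Aw j = 1"
  shows "ereal ((a - 1) / 2) \<le> eps_star n b w Ab Aw"
proof (rule le_eps_star)
  fix v e assume "feasible n b w Ab Aw v e"
  then obtain x where x: "\<bar>x - Ab w\<bar> \<le> e"
    "e \<le> Ab i \<Longrightarrow> e \<le> Aw i \<Longrightarrow> (Ab i - e) * (Aw i - e) \<le> x" "x \<le> (Ab j + e) * (Aw j + e)"
    using feasible_ratio assms by metis
  show "(a - 1) / 2 \<le> e"
  proof (cases "e \<le> a")
    case True
    then have "(a - e)\<^sup>2 \<le> (1 + e)\<^sup>2" using x i j by (simp add: power2_eq_square)
    moreover have "0 \<le> 1 + e" using x by simp
    ultimately have "a - e \<le> 1 + e" by (rule power2_le_imp_le)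
    then show ?thesis by simp
  next
    case False
    then show ?thesis using assms by simp
  qed
qed

text \<open>
  The criteria in \<open>S\<close> are judged equal to both extremes and all others as far as possible from
  both.  The empty \<open>S\<close> realizes the conflict of a single criterion with the comparison of \<open>b\<close>
  and \<open>w\<close>, a singleton \<open>S\<close> in addition that of two criteria.
\<close>

lemma is_pcs_extremal:
  assumes "1 \<le> a" "b \<noteq> w" "S \<subseteq> criteria n - {b, w}"
  shows "is_pcs n b w (\<lambda>k. if k \<in> insert b S then 1 else a) (\<lambda>k. if k \<in> insert w S then 1 else a)"
  using assms by (auto simp: is_pcs_def)

section \<open>The consistency index\<close>

theorem mainTheorem5:
  fixes n b w :: nat and a :: real
  assumes "3 \<le> n" and "1 \<le> a"
    and "b \<in> criteria n" and "w \<in> criteria n" and "b \<noteq> w"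
  shows "CI b w a n =
    ereal (if n = 3 then (2 * a + 1 - sqrt (8 * a + 1)) / 2
           else max ((2 * a + 1 - sqrt (8 * a + 1)) / 2) ((a\<^sup>2 - 1) / (2 * a + 2)))"
proof -
  have half: "(a\<^sup>2 - 1) / (2 * a + 2) = (a - 1) / 2"
    using assms by (simp add: field_simps power2_eq_square)
  let ?B = "\<lambda>S k. if k \<in> insert b S then 1 else a"
  let ?W = "\<lambda>S k. if k \<in> insert w S then 1 else a"
  have ext: "eps_star n b w (?B S) (?W S) \<le> CI b w a n" if "S \<subseteq> criteria n - {b, w}" for S
  proof -
    have "?B S w = a" using that assms by auto
    then show ?thesis
      unfolding CI_def using is_pcs_extremal[OF \<open>1 \<le> a\<close> \<open>b \<noteq> w\<close> that] by (intro Sup_upper) blast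
  qed
  have card: "card (criteria n - {b, w}) = n - 2"
    using assms by (simp add: card_Diff_subset criteria_def)
  show ?thesis
  proof (cases "n = 3")
    case True
    have "card (criteria n - {b, w}) = 1" using card True by simp
    then obtain i where "criteria n - {b, w} = {i}" by (rule card_1_singletonE)
    then have "i \<in> criteria n - {b, w}" by blast
    then have "ereal (single_bound a) \<le> eps_star n b w (?B {}) (?W {})"
      using assms by (intro single_bound_le_eps_star[where i = i]) auto
    also have "\<dots> \<le> CI b w a n" by (rule ext) simp
    finally have "ereal (single_bound a) \<le> CI b w a n" .
    moreover have "CI b w a n \<le> ereal (single_bound a)"
      unfolding CI_def using eps_star_le_single_bound assms True by (intro Sup_least) blast
    ultimately show ?thesis using True by (simp add: single_bound_def)
  next
    case False
    then have "2 \<le> card (criteria n - {b, w})" using card assms by simp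
    then obtain T where "T \<subseteq> criteria n - {b, w}" "card T = 2"
      by (rule obtain_subset_with_card_n)
    then obtain i j where i: "i \<in> criteria n - {b, w}" and j: "j \<in> criteria n - {b, w}"
      and "i \<noteq> j"
      by (auto simp: card_2_iff)
    have "ereal (single_bound a) \<le> eps_star n b w (?B {j}) (?W {j})"
      using i j \<open>i \<noteq> j\<close> assms by (intro single_bound_le_eps_star[where i = i]) auto
    moreover have "ereal ((a - 1) / 2) \<le> eps_star n b w (?B {j}) (?W {j})"
      using i j \<open>i \<noteq> j\<close> assms by (intro half_le_eps_star[where i = i and j = j]) auto
    ultimately have "ereal (max (single_bound a) ((a - 1) / 2)) \<le> eps_star n b w (?B {j}) (?W {j})"
      by (simp add: max_def)
    also have "\<dots> \<le> CI b w a n" using j by (intro ext) simp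
    finally have "ereal (max (single_bound a) ((a - 1) / 2)) \<le> CI b w a n" .
    moreover have "CI b w a n \<le> ereal (max (single_bound a) ((a - 1) / 2))"
      unfolding CI_def using eps_star_le_max assms by (intro Sup_least) blast
    ultimately show ?thesis using False by (simp only: half single_bound_def if_False order.antisym)
  qed
qed

end
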